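(* Let $(X,d)$ be a complete, proper, separable metric space which is a length space. For all $a\ge0$, $b>0$ and $\mu_0,\mu_1\in\mathcal P(X)$, we have $T_{a,b}(\mu_0,\mu_1)\ge C_b$, with equality if and only if $\mu_0=\mu_1$. Thus $$\widetilde T_{a,b}(\mu_0,\mu_1):=\ln\left(\frac{1}{C_b}T_{a,b}(\mu_0,\mu_1)\right)$$ is a statistical divergence on $\mathcal P(X)$; that is, $\widetilde T_{a,b}(\mu_0,\mu_1)\ge0$ with equality if and only if $\mu_0=\mu_1$.
   Context: For $f:X\to\mathbb R$, $|\nabla f|(x)=\lim_{r\to0}\sup_{0<d(x,y)\le r}\frac{|f(x)-f(y)|}{d(x,y)}$. $\mathrm{Lip}_b(X)$ is the Banach space of bounded Lipschitz functions on $X$ and $\mathcal P(X)$ the set of Borel probability measures on $X$. For $b>0$ put $p=e^b$, $q=p/(p-1)$ and $C_b=\frac1q p^{-q/p}=\frac1q p^{1-q}$. For $a,b\ge0$ let $\mathcal E_{a,b}$ be the class of all positive functions $\varphi\in C^1([0,1],\mathrm{Lip}_b(X))$, bounded and bounded away from $0$, satisfying $\partial_s\varphi_s+a\varphi_s|\nabla\ln\varphi_s|^2+b\varphi_s\ln\varphi_s\le0$. For $\mu_0,\mu_1\in\mathcal P(X)$ set $T_{a,b}(\mu_0,\mu_1)=\sup_{\varphi\in\mathcal E_{a,b}}\left[\int_X\varphi_1\,d\mu_1-\int_X\varphi_0\,d\mu_0\right]$ (possibly $+\infty$). *)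

theory Defs
  imports "HOL-Probability.Probability_Measure"
begin

text \<open>
  Only the restriction of \<open>g\<close> to \<open>[0,1]\<close> matters; a partition is a weakly increasing
  \<open>t 0 \<le> \<dots> \<le> t n\<close>, and repeated points contribute \<open>0\<close>.
\<close>

definition curve_length :: "(real \<Rightarrow> 'a::metric_space) \<Rightarrow> ennreal" where
  "curve_length g =
     (SUP (n, t) \<in> {(n :: nat, t :: nat \<Rightarrow> real). mono_on {..n} t \<and> t ` {..n} \<subseteq> {0..1}}.
        \<Sum>i<n. ennreal (dist (g (t i)) (g (t (Suc i)))))"

definition length_space :: "'a::metric_space itself \<Rightarrow> bool" where
  "length_space _ \<longleftrightarrow>
     (\<forall>x y :: 'a. ennreal (dist x y) =
        (INF g \<in> {g. path g \<and> pathstart g = x \<and> pathfinish g = y}. curve_length g))"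

typedef (overloaded) 'a lipb =
  "{f :: 'a::metric_space \<Rightarrow> real. bounded (range f) \<and> (\<exists>L. L-lipschitz_on UNIV f)}"
  morphisms apply_lipb Lipb
  by (rule exI[of _ "\<lambda>_. 0"]) (auto simp: lipschitz_on_def)

declare [[coercion "apply_lipb :: 'a::metric_space lipb \<Rightarrow> 'a \<Rightarrow> real"]]

setup_lifting type_definition_lipb

text \<open>
  The least Lipschitz constant. The set is nonempty for a Lipschitz function and its infimum is
  attained (see below); unlike the supremum of difference quotients over \<open>x \<noteq> y\<close>, this is also
  meaningful (namely \<open>0\<close>) on a one-point space.
\<close>

definition lip_const :: "('a::metric_space \<Rightarrow> real) \<Rightarrow> real" where
  "lip_const f = Inf {L. L-lipschitz_on UNIV f}"

lemma lipb_bounded: "bounded (range (apply_lipb f))"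
  and lipb_lipschitz_ex: "\<exists>L. L-lipschitz_on UNIV (apply_lipb f)"
  using apply_lipb[of f] by auto

lemma lipb_eqI: "(\<And>x. apply_lipb f x = apply_lipb g x) \<Longrightarrow> f = g"
  by transfer auto

lemma lip_const_le:
  assumes "L-lipschitz_on UNIV f"
  shows "lip_const f \<le> L"
  unfolding lip_const_def
  by (rule cInf_lower) (use assms in \<open>auto intro!: bdd_belowI[of _ 0] simp: lipschitz_on_def\<close>)

lemma lip_const_lipschitz:
  assumes "\<exists>L. L-lipschitz_on UNIV f"
  shows "(lip_const f)-lipschitz_on UNIV f"
proof (rule lipschitz_onI)
  have ne: "{L. L-lipschitz_on UNIV f} \<noteq> {}"
    using assms by auto
  show "0 \<le> lip_const f"
    unfolding lip_const_def using ne by (rule cInf_greatest) (auto simp: lipschitz_on_def)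
  fix x y
  show "dist (f x) (f y) \<le> lip_const f * dist x y"
  proof (cases "x = y")
    case False
    hence "dist (f x) (f y) / dist x y \<le> lip_const f"
      unfolding lip_const_def
      by (intro cInf_greatest[OF ne]) (auto simp: lipschitz_on_def divide_le_eq)
    with False show ?thesis
      by (simp add: divide_le_eq)
  qed auto
qed

lemma lipb_add_closed:
  fixes f g :: "'a::metric_space \<Rightarrow> real"
  assumes "L-lipschitz_on UNIV f" "M-lipschitz_on UNIV g"
  shows "(L + M)-lipschitz_on UNIV (\<lambda>x. f x + g x)"
  using assms by (intro lipschitz_intros)

lemma lipb_scaleR_closed:
  fixes f :: "'a::metric_space \<Rightarrow> real"
  assumes "L-lipschitz_on UNIV f"
  shows "(\<bar>c\<bar> * L)-lipschitz_on UNIV (\<lambda>x. c * f x)"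
proof (rule lipschitz_onI)
  show "0 \<le> \<bar>c\<bar> * L" using assms by (simp add: lipschitz_on_def)
  fix x y
  have "dist (c * f x) (c * f y) = \<bar>c\<bar> * dist (f x) (f y)"
    by (simp add: dist_real_def flip: right_diff_distrib abs_mult)
  also have "\<dots> \<le> \<bar>c\<bar> * (L * dist x y)"
    by (rule mult_left_mono) (use assms in \<open>auto simp: lipschitz_on_def\<close>)
  finally show "dist (c * f x) (c * f y) \<le> \<bar>c\<bar> * L * dist x y" by (simp add: mult.assoc)
qed

instantiation lipb :: (metric_space) real_vector
begin

lift_definition zero_lipb :: "'a lipb" is "\<lambda>_. 0"
  by (auto simp: lipschitz_on_def)

lift_definition plus_lipb :: "'a lipb \<Rightarrow> 'a lipb \<Rightarrow> 'a lipb" is "\<lambda>f g x. f x + g x"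
  by (auto intro: bounded_plus_comp lipb_add_closed)

lift_definition uminus_lipb :: "'a lipb \<Rightarrow> 'a lipb" is "\<lambda>f x. - f x"
  by (auto simp: lipschitz_on_minus_iff)

lift_definition minus_lipb :: "'a lipb \<Rightarrow> 'a lipb \<Rightarrow> 'a lipb" is "\<lambda>f g x. f x - g x"
proof -
  fix f g :: "'a \<Rightarrow> real"
  assume "bounded (range f) \<and> (\<exists>L. L-lipschitz_on UNIV f)"
    and "bounded (range g) \<and> (\<exists>L. L-lipschitz_on UNIV g)"
  thus "bounded (range (\<lambda>x. f x - g x)) \<and> (\<exists>L. L-lipschitz_on UNIV (\<lambda>x. f x - g x))"
    by (auto intro: bounded_minus_comp lipschitz_on_diff)
qed

lift_definition scaleR_lipb :: "real \<Rightarrow> 'a lipb \<Rightarrow> 'a lipb" is "\<lambda>c f x. c * f x"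
proof -
  fix c and f :: "'a \<Rightarrow> real"
  assume "bounded (range f) \<and> (\<exists>L. L-lipschitz_on UNIV f)"
  thus "bounded (range (\<lambda>x. c * f x)) \<and> (\<exists>L. L-lipschitz_on UNIV (\<lambda>x. c * f x))"
    using bounded_scaleR_comp[of f UNIV c] by (auto intro: lipb_scaleR_closed)
qed

lemmas lipb_rep_eq [simp] =
  zero_lipb.rep_eq plus_lipb.rep_eq uminus_lipb.rep_eq minus_lipb.rep_eq scaleR_lipb.rep_eq

instance
  by standard (auto intro!: lipb_eqI simp: algebra_simps)

end

instantiation lipb :: (metric_space) real_normed_vector
begin

definition norm_lipb :: "'a lipb \<Rightarrow> real" where
  "norm_lipb f = (SUP x. \<bar>f x\<bar>) + lip_const f"

definition dist_lipb :: "'a lipb \<Rightarrow> 'a lipb \<Rightarrow> real" where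
  "dist_lipb f g = norm (f - g)"

definition sgn_lipb :: "'a lipb \<Rightarrow> 'a lipb" where
  "sgn_lipb f = f /\<^sub>R norm f"

definition uniformity_lipb :: "('a lipb \<times> 'a lipb) filter" where
  "uniformity_lipb = (INF e\<in>{0 <..}. principal {(x, y). dist x y < e})"

definition open_lipb :: "'a lipb set \<Rightarrow> bool" where
  "open_lipb S = (\<forall>x\<in>S. \<forall>\<^sub>F (x', y) in uniformity. x' = x \<longrightarrow> y \<in> S)"

lemma lipb_lipschitz: "(lip_const (apply_lipb f))-lipschitz_on UNIV (apply_lipb f)"
  by (rule lip_const_lipschitz[OF lipb_lipschitz_ex])

lemma lip_const_nonneg: "0 \<le> lip_const (apply_lipb f)"
  using lipb_lipschitz by (rule lipschitz_on_nonneg)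

lemma lipb_abs_le_SUP: "\<bar>apply_lipb f x\<bar> \<le> (SUP x. \<bar>apply_lipb f x\<bar>)"
proof (rule cSUP_upper)
  show "bdd_above (range (\<lambda>x. \<bar>apply_lipb f x\<bar>))"
    using lipb_bounded[of f] by (auto simp: bounded_iff bdd_above_def)
qed auto

lemma norm_lipb_le:
  fixes f :: "'a lipb"
  assumes "\<And>x. \<bar>f x\<bar> \<le> B" "L-lipschitz_on UNIV (apply_lipb f)"
  shows "norm f \<le> B + L"
  unfolding norm_lipb_def
  by (intro add_mono cSUP_least lip_const_le assms) auto

lemma abs_le_norm_lipb: "\<bar>apply_lipb f x\<bar> \<le> norm f"
  unfolding norm_lipb_def using lipb_abs_le_SUP[of f x] lip_const_nonneg[of f] by linarith

lemma lip_const_le_norm_lipb: "lip_const (apply_lipb f) \<le> norm f"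
  unfolding norm_lipb_def using lipb_abs_le_SUP[of f undefined] by linarith

instance
proof
  fix f g :: "'a lipb" and c :: real
  show "dist f g = norm (f - g)" by (rule dist_lipb_def)
  show "sgn f = f /\<^sub>R norm f" by (rule sgn_lipb_def)
  show "uniformity = (INF e\<in>{0 <..}. principal {(x, y). dist (x::'a lipb) y < e})"
    by (rule uniformity_lipb_def)
  show "open U = (\<forall>x\<in>U. \<forall>\<^sub>F (x', y) in uniformity. x' = x \<longrightarrow> y \<in> U)" for U :: "'a lipb set"
    by (rule open_lipb_def)
  have zero: "norm (0 :: 'a lipb) = 0"
  proof (rule antisym)
    show "norm (0 :: 'a lipb) \<le> 0"
      using norm_lipb_le[of "0 :: 'a lipb" 0 0] by (simp add: lipschitz_on_def)
    show "0 \<le> norm (0 :: 'a lipb)"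
      using abs_le_norm_lipb[of "0 :: 'a lipb"] by simp
  qed
  show "norm f = 0 \<longleftrightarrow> f = 0"
  proof
    assume "norm f = 0"
    with abs_le_norm_lipb[of f] show "f = 0" by (intro lipb_eqI) auto
  qed (simp add: zero)
  show "norm (f + g) \<le> norm f + norm g"
  proof -
    have "norm (f + g) \<le> ((SUP x. \<bar>f x\<bar>) + (SUP x. \<bar>g x\<bar>)) + (lip_const f + lip_const g)"
    proof (rule norm_lipb_le)
      show "\<bar>(f + g) x\<bar> \<le> (SUP x. \<bar>f x\<bar>) + (SUP x. \<bar>g x\<bar>)" for x
        using lipb_abs_le_SUP[of f x] lipb_abs_le_SUP[of g x] by simp
      show "(lip_const f + lip_const g)-lipschitz_on UNIV (apply_lipb (f + g))"
        unfolding plus_lipb.rep_eq by (intro lipb_add_closed lipb_lipschitz)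
    qed
    thus ?thesis by (simp add: norm_lipb_def)
  qed
  have scale: "norm (c *\<^sub>R f) \<le> \<bar>c\<bar> * norm f" for c and f :: "'a lipb"
  proof -
    have "norm (c *\<^sub>R f) \<le> \<bar>c\<bar> * (SUP x. \<bar>f x\<bar>) + \<bar>c\<bar> * lip_const f"
    proof (rule norm_lipb_le)
      show "\<bar>(c *\<^sub>R f) x\<bar> \<le> \<bar>c\<bar> * (SUP x. \<bar>f x\<bar>)" for x
        using lipb_abs_le_SUP[of f x] by (simp add: abs_mult mult_left_mono)
      show "(\<bar>c\<bar> * lip_const f)-lipschitz_on UNIV (apply_lipb (c *\<^sub>R f))"
        unfolding scaleR_lipb.rep_eq by (intro lipb_scaleR_closed lipb_lipschitz)
    qed
    thus ?thesis by (simp add: norm_lipb_def distrib_left)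
  qed
  show "norm (c *\<^sub>R f) = \<bar>c\<bar> * norm f"
  proof (cases "c = 0")
    case False
    have "\<bar>c\<bar> * norm f = \<bar>c\<bar> * norm (inverse c *\<^sub>R (c *\<^sub>R f))" using False by simp
    also have "\<dots> \<le> \<bar>c\<bar> * (\<bar>inverse c\<bar> * norm (c *\<^sub>R f))"
      by (intro mult_left_mono scale) auto
    also have "\<dots> = norm (c *\<^sub>R f)" using False by (simp add: abs_inverse)
    finally show ?thesis using scale[of c f] by simp
  qed (simp add: zero)
qed

end

instance lipb :: (metric_space) banach
proof
  fix F :: "nat \<Rightarrow> 'a lipb"
  assume "Cauchy F"
  have point: "Cauchy (\<lambda>n. F n x)" for x
  proof (rule metric_CauchyI)
    fix e :: real assume "0 < e"
    from metric_CauchyD[OF \<open>Cauchy F\<close> this] obtain N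
      where N: "dist (F m) (F n) < e" if "m \<ge> N" "n \<ge> N" for m n by auto
    have "dist (F m x) (F n x) < e" if "m \<ge> N" "n \<ge> N" for m n
      using abs_le_norm_lipb[of "F m - F n" x] N[OF that] by (simp add: dist_norm)
    thus "\<exists>M. \<forall>m\<ge>M. \<forall>n\<ge>M. dist (F m x) (F n x) < e" by blast
  qed
  define h where "h x = lim (\<lambda>n. F n x)" for x
  have h: "(\<lambda>n. F n x) \<longlonglongrightarrow> h x" for x
    using point[of x] unfolding h_def Cauchy_convergent_iff convergent_LIMSEQ_iff .
  have close: "\<exists>N. \<forall>n\<ge>N. (\<forall>x. \<bar>F n x - h x\<bar> \<le> e) \<and> e-lipschitz_on UNIV (\<lambda>x. F n x - h x)"
    if "0 < e" for e :: real
  proof -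
    from metric_CauchyD[OF \<open>Cauchy F\<close> that] obtain N
      where N: "dist (F m) (F n) < e" if "m \<ge> N" "n \<ge> N" for m n by auto
    have "(\<forall>x. \<bar>F n x - h x\<bar> \<le> e) \<and> e-lipschitz_on UNIV (\<lambda>x. F n x - h x)" if n: "n \<ge> N" for n
    proof (intro conjI allI lipschitz_onI)
      fix x
      show "\<bar>F n x - h x\<bar> \<le> e"
      proof (rule tendsto_upperbound)
        show "(\<lambda>m. \<bar>F n x - F m x\<bar>) \<longlonglongrightarrow> \<bar>F n x - h x\<bar>"
          by (intro tendsto_intros h)
        show "\<forall>\<^sub>F m in sequentially. \<bar>F n x - F m x\<bar> \<le> e"
          using eventually_ge_at_top[of N]
        proof eventually_elim
          case (elim m)
          thus ?case
            using abs_le_norm_lipb[of "F n - F m" x] N[OF n elim] by (simp add: dist_norm)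
        qed
      qed auto
    next
      fix x y
      show "dist (F n x - h x) (F n y - h y) \<le> e * dist x y"
      proof (rule tendsto_upperbound)
        show "(\<lambda>m. dist (F n x - F m x) (F n y - F m y)) \<longlonglongrightarrow> dist (F n x - h x) (F n y - h y)"
          by (intro tendsto_intros h)
        show "\<forall>\<^sub>F m in sequentially. dist (F n x - F m x) (F n y - F m y) \<le> e * dist x y"
          using eventually_ge_at_top[of N]
        proof eventually_elim
          case (elim m)
          have "dist ((F n - F m) x) ((F n - F m) y) \<le> lip_const (F n - F m) * dist x y"
            by (rule lipschitz_onD[OF lipb_lipschitz]) auto
          also have "\<dots> \<le> e * dist x y"
            using lip_const_le_norm_lipb[of "F n - F m"] N[OF n elim]
            by (intro mult_right_mono) (auto simp: dist_norm)
          finally show ?case by simp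
        qed
      qed auto
    qed (use \<open>0 < e\<close> in auto)
    thus ?thesis by blast
  qed
  have "bounded (range h) \<and> (\<exists>L. L-lipschitz_on UNIV h)"
  proof -
    from close[of 1] obtain n where n: "\<And>x. \<bar>F n x - h x\<bar> \<le> 1"
      "1-lipschitz_on UNIV (\<lambda>x. F n x - h x)" by auto
    have "\<bar>h x\<bar> \<le> norm (F n) + 1" for x
      using abs_le_norm_lipb[of "F n" x] n(1)[of x] by linarith
    hence "bounded (range h)" by (auto intro!: boundedI)
    moreover have "(lip_const (F n) + 1)-lipschitz_on UNIV (\<lambda>x. F n x - (F n x - h x))"
      by (intro lipschitz_on_diff lipb_lipschitz n)
    ultimately show ?thesis by auto
  qed
  then obtain H :: "'a lipb" where H: "apply_lipb H = h"
    using Lipb_inverse[of h] by auto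
  have "F \<longlonglongrightarrow> H"
  proof (rule metric_LIMSEQ_I)
    fix e :: real assume "0 < e"
    hence "0 < e / 3" by simp
    from close[OF this] obtain N where N: "(\<forall>x. \<bar>F n x - h x\<bar> \<le> e / 3) \<and>
      (e / 3)-lipschitz_on UNIV (\<lambda>x. F n x - h x)" if "n \<ge> N" for n by blast
    have "dist (F n) H < e" if "n \<ge> N" for n
    proof -
      have "norm (F n - H) \<le> e / 3 + e / 3"
        by (rule norm_lipb_le) (use N[OF that] in \<open>auto simp: H\<close>)
      thus ?thesis using \<open>0 < e\<close> by (simp add: dist_norm)
    qed
    thus "\<exists>N. \<forall>n\<ge>N. dist (F n) H < e" by blast
  qed
  thus "convergent F" by (rule convergentI)
qed

text \<open>
  \<open>|\<nabla>f|(x)\<close>, with values in \<open>[0,\<infinity>]\<close>. The supremum over the empty set is \<open>0\<close> in \<^typ>\<open>ennreal\<close>,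
  so the slope vanishes at isolated points.
\<close>

definition local_slope :: "('a::metric_space \<Rightarrow> real) \<Rightarrow> 'a \<Rightarrow> ennreal" where
  "local_slope f x =
     Lim (at_right 0) (\<lambda>r::real. SUP y \<in> {y. 0 < dist x y \<and> dist x y \<le> r}.
        ennreal (\<bar>f x - f y\<bar> / dist x y))"

lemma local_slope_tendsto:
  fixes f :: "'a::metric_space \<Rightarrow> real"
  defines "S \<equiv> \<lambda>x r. SUP y \<in> {y. 0 < dist x y \<and> dist x y \<le> r}. ennreal (\<bar>f x - f y\<bar> / dist x y)"
  shows "((\<lambda>r. S x r) \<longlongrightarrow> (INF r\<in>{0<..}. S x r)) (at_right 0)"
proof (rule order_tendstoI)
  fix c assume "c < (INF r\<in>{0<..}. S x r)"
  hence "c < S x r" if "r > 0" for r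
    using that by (meson INF_lower greaterThan_iff less_le_trans)
  thus "\<forall>\<^sub>F r in at_right 0. c < S x r"
    by (auto simp: eventually_at_filter)
next
  fix c assume "(INF r\<in>{0<..}. S x r) < c"
  then obtain r where r: "r > 0" "S x r < c" by (auto simp: INF_less_iff)
  have "S x r' \<le> S x r" if "r' \<le> r" for r'
    unfolding S_def using that by (intro SUP_subset_mono) auto
  with r show "\<forall>\<^sub>F r in at_right 0. S x r < c"
    unfolding eventually_at_right_field by (meson le_less_trans less_imp_le)
qed

lemma local_slope_eq_INF:
  fixes f :: "'a::metric_space \<Rightarrow> real"
  shows "local_slope f x = (INF r\<in>{0<..}. SUP y \<in> {y. 0 < dist x y \<and> dist x y \<le> r}.
           ennreal (\<bar>f x - f y\<bar> / dist x y))"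
  unfolding local_slope_def by (rule tendsto_Lim[OF _ local_slope_tendsto]) simp

lemma local_slope_le:
  assumes "L-lipschitz_on UNIV f"
  shows "local_slope f x \<le> ennreal L"
  unfolding local_slope_eq_INF
proof (rule INF_lower2[of 1])
  show "(SUP y \<in> {y. 0 < dist x y \<and> dist x y \<le> 1}. ennreal (\<bar>f x - f y\<bar> / dist x y)) \<le> ennreal L"
  proof (rule SUP_least)
    fix y assume "y \<in> {y. 0 < dist x y \<and> dist x y \<le> 1}"
    thus "ennreal (\<bar>f x - f y\<bar> / dist x y) \<le> ennreal L"
      using assms by (intro ennreal_leI) (auto simp: lipschitz_on_def dist_real_def divide_le_eq)
  qed
qed simp

text \<open>
  In the differential inequality below, the slope is only applied to \<open>ln \<circ> f\<close> with \<open>f\<close> Lipschitz and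
  bounded away from \<open>0\<close>, where it is finite, so that \<^const>\<open>enn2real\<close> loses nothing.
\<close>

lemma local_slope_ln_finite:
  fixes f :: "'a::metric_space lipb"
  assumes "0 < c" "\<And>x. c \<le> f x"
  shows "local_slope (\<lambda>x. ln (f x)) x < \<infinity>"
proof -
  have *: "ln (f x) - ln (f y) \<le> lip_const f / c * dist x y" for x y
  proof -
    have pos: "0 < f x" "0 < f y" using assms less_le_trans by blast+
    have "ln (f x) - ln (f y) = ln (f x / f y)" using pos by (simp add: ln_div)
    also have "\<dots> \<le> f x / f y - 1" using pos by (intro ln_le_minus_one) auto
    also have "\<dots> = (f x - f y) / f y" using pos by (simp add: field_simps)
    also have "\<dots> \<le> (lip_const f * dist x y) / f y"
      using lipschitz_onD[OF lipb_lipschitz, of x y f] pos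
      by (intro divide_right_mono) (auto simp: dist_real_def)
    also have "\<dots> \<le> (lip_const f * dist x y) / c"
      using assms pos lip_const_nonneg[of f] by (intro divide_left_mono) auto
    finally show ?thesis by simp
  qed
  have "(lip_const f / c)-lipschitz_on UNIV (\<lambda>x. ln (f x))"
  proof (rule lipschitz_onI)
    fix x y
    show "dist (ln (f x)) (ln (f y)) \<le> lip_const f / c * dist x y"
      using *[of x y] *[of y x] by (auto simp: dist_real_def dist_commute abs_le_iff)
  qed (use assms lip_const_nonneg[of f] in auto)
  from local_slope_le[OF this, of x] have "local_slope (\<lambda>x. ln (f x)) x \<le> ennreal (lip_const f / c)" .
  also have "\<dots> < \<infinity>" by simp
  finally show ?thesis .
qed

text \<open>
  A curve \<open>\<phi>\<close> in \<^typ>\<open>'a lipb\<close> is only constrained on \<open>[0,1]\<close>; the derivative is that of the Banach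
  space \<^typ>\<open>'a lipb\<close>, one-sided at the endpoints.
\<close>

definition E_class :: "real \<Rightarrow> real \<Rightarrow> (real \<Rightarrow> 'a::metric_space lipb) set" where
  "E_class a b = {\<phi> :: real \<Rightarrow> 'a lipb.
     (\<exists>c>0. \<exists>M. \<forall>s\<in>{0..1}. \<forall>x. c \<le> apply_lipb (\<phi> s) x \<and> apply_lipb (\<phi> s) x \<le> M) \<and>
     (\<exists>\<phi>' :: real \<Rightarrow> 'a lipb.
           (\<forall>s\<in>{0..1}. (\<phi> has_vector_derivative \<phi>' s) (at s within {0..1})) \<and>
           continuous_on {0..1} \<phi>' \<and>
           (\<forall>s\<in>{0..1}. \<forall>x.
              apply_lipb (\<phi>' s) x
                + a * apply_lipb (\<phi> s) x * (enn2real (local_slope (\<lambda>y. ln (apply_lipb (\<phi> s) y)) x))\<^sup>2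
                + b * apply_lipb (\<phi> s) x * ln (apply_lipb (\<phi> s) x) \<le> 0))}"

definition T_cost :: "real \<Rightarrow> real \<Rightarrow> 'a::metric_space measure \<Rightarrow> 'a measure \<Rightarrow> ereal" where
  "T_cost a b \<mu>0 \<mu>1 =
     (SUP \<phi> \<in> E_class a b. ereal ((\<integral>x. apply_lipb (\<phi> 1) x \<partial>\<mu>1) - (\<integral>x. apply_lipb (\<phi> 0) x \<partial>\<mu>0)))"

definition C_const :: "real \<Rightarrow> real" where
  "C_const b = (let p = exp b; q = p / (p - 1) in 1 / q * p powr (- q / p))"

definition ln_ereal :: "ereal \<Rightarrow> ereal" where
  "ln_ereal x = (if x = \<infinity> then \<infinity> else if x \<le> 0 then - \<infinity> else ereal (ln (real_of_ereal x)))"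

definition T_tilde :: "real \<Rightarrow> real \<Rightarrow> 'a::metric_space measure \<Rightarrow> 'a measure \<Rightarrow> ereal" where
  "T_tilde a b \<mu>0 \<mu>1 = ln_ereal (ereal (1 / C_const b) * T_cost a b \<mu>0 \<mu>1)"

definition borel_probs :: "'a::topological_space measure set" where
  "borel_probs = {\<mu>. prob_space \<mu> \<and> sets \<mu> = sets borel}"

end

theory Submission
  imports Defs
begin

text \<open>
  On spatially constant functions the slope vanishes and the equality case of the differential
  inequality is the ODE \<open>y' = - b y ln y\<close>, solved by \<open>y s = exp (c e\<^sup>-\<^sup>b\<^sup>s)\<close>. With \<open>p = e\<^sup>b\<close> the gap
  between the end values is \<open>y 1 - y 0 = (y 0) powr (1/p) - y 0\<close>, and \<open>C_const b\<close> is the maximum of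
  this over \<open>y 0\<close> (\<open>C_const_background\<close>, \<open>exp_gap_le_C_const\<close>). The maximising curve gives
  \<open>T \<ge> C_const b\<close> for every pair of measures.

  If both measures are \<open>\<mu>\<close>, this is optimal. The slope term is nonnegative, so dropping it shows that
  \<open>e\<^sup>b\<^sup>s ln \<phi>\<^sub>s(x)\<close> decreases for every \<open>\<phi>\<close> in the class and every \<open>x\<close>
  (\<open>E_class_ln_decay\<close>). Hence \<open>\<phi>\<^sub>1 - \<phi>\<^sub>0 \<le> C_const b\<close> pointwise, and one integrates.

  If the measures differ, some bounded Lipschitz \<open>f\<close> has a larger integral against the second
  (\<open>lipb_separates_measures\<close>). The optimal constant curve is perturbed by \<open>\<epsilon> f\<close> times a solution of
  the linearised ODE. The failure of the differential inequality caused by the slope of \<open>f\<close> and by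
  the nonlinearity is of order \<open>\<epsilon>\<^sup>2\<close>, so it is paid for by a correction \<open>- \<epsilon>\<^sup>2 K s\<close>
  (\<open>perturbed_curve_in_E_class\<close>). At the maximiser the first-order weights of the two end values
  coincide (\<open>background_balance\<close>), so the value is \<open>C_const b\<close> plus a positive multiple of
  \<open>\<epsilon> (\<integral> f d\<mu>1 - \<integral> f d\<mu>0) - \<epsilon>\<^sup>2 K\<close>, which exceeds \<open>C_const b\<close> for small \<open>\<epsilon> > 0\<close>.
\<close>

section \<open>Bounded Lipschitz functions\<close>

lift_definition unit_lipb :: "'a::metric_space lipb" is "\<lambda>_. 1"
  by (auto simp: lipschitz_on_def)

lemma bounded_linear_apply_lipb: "bounded_linear (\<lambda>f. apply_lipb f x)"
  by (rule bounded_linear_intro[where K = 1]) (auto simp: abs_le_norm_lipb)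

lemma continuous_on_apply_lipb: "continuous_on UNIV (apply_lipb f)"
  using lipb_lipschitz[of f] by (rule lipschitz_on_continuous_on)

lemma integrable_apply_lipb:
  fixes \<mu> :: "'a::metric_space measure"
  assumes "\<mu> \<in> borel_probs"
  shows "integrable \<mu> (apply_lipb f)"
proof -
  interpret prob_space \<mu> using assms by (simp add: borel_probs_def)
  have "borel_measurable \<mu> = (borel_measurable borel :: ('a \<Rightarrow> real) set)"
    using assms by (intro measurable_cong_sets) (auto simp: borel_probs_def)
  hence "apply_lipb f \<in> borel_measurable \<mu>"
    using borel_measurable_continuous_onI[OF continuous_on_apply_lipb[of f]] by simp
  thus ?thesis
    by (intro integrable_const_bound[where B = "norm f"]) (auto simp: abs_le_norm_lipb)
qed

text \<open>As \<open>n\<close> grows, these functions decrease to the indicator of the closure of \<open>C\<close>, for \<open>C\<close> nonempty.\<close>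

lemma closed_distance_profile_lipb:
  fixes C :: "'a::metric_space set" and n :: nat
  obtains f :: "'a lipb" where "apply_lipb f = (\<lambda>x. max 0 (1 - real n * infdist x C))"
proof -
  have "(real n)-lipschitz_on UNIV (\<lambda>x. max 0 (1 - real n * infdist x C))"
  proof (rule lipschitz_onI)
    fix x y :: 'a
    have "dist (max 0 (1 - real n * infdist x C)) (max 0 (1 - real n * infdist y C))
        \<le> \<bar>real n * (infdist x C - infdist y C)\<bar>"
      by (auto simp: dist_real_def max_def abs_if algebra_simps)
    also have "\<dots> \<le> real n * dist x y"
      by (simp add: abs_mult mult_left_mono infdist_triangle_abs)
    finally show "dist (max 0 (1 - real n * infdist x C)) (max 0 (1 - real n * infdist y C))
        \<le> real n * dist x y" .
  qed simp
  moreover have "bounded (range (\<lambda>x. max 0 (1 - real n * infdist x C)))"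
    by (intro boundedI[where B = 1]) (auto simp: infdist_nonneg)
  ultimately show thesis
    using Lipb_inverse[of "\<lambda>x. max 0 (1 - real n * infdist x C)"] that by blast
qed

lemma borel_probs_eqI_closed:
  fixes \<mu> \<nu> :: "'a::metric_space measure"
  assumes "\<mu> \<in> borel_probs" "\<nu> \<in> borel_probs"
    and "\<And>C. closed C \<Longrightarrow> measure \<mu> C = measure \<nu> C"
  shows "\<mu> = \<nu>"
proof -
  interpret M: prob_space \<mu> using assms by (simp add: borel_probs_def)
  interpret N: prob_space \<nu> using assms by (simp add: borel_probs_def)
  have sets: "sets \<mu> = sets borel" "sets \<nu> = sets borel"
    using assms by (auto simp: borel_probs_def)
  have gen: "sets (borel :: 'a measure) = sigma_sets UNIV (Collect closed)"
    by (simp add: borel_eq_closed)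
  show ?thesis
  proof (rule measure_eqI_generator_eq[where E = "Collect closed" and \<Omega> = UNIV and A = "\<lambda>_. UNIV"])
    show "Int_stable (Collect (closed :: 'a set \<Rightarrow> bool))"
      by (auto simp: Int_stable_def)
    show "emeasure \<mu> X = emeasure \<nu> X" if "X \<in> Collect closed" for X
      using assms(3)[of X] that by (simp add: M.emeasure_eq_measure N.emeasure_eq_measure)
  qed (auto simp: sets gen M.emeasure_eq_measure)
qed

text \<open>
  The set has to be nonempty because \<open>infdist x {} = 0\<close> by convention, which would turn the limit into \<open>1\<close>.
\<close>

lemma measure_closed_eq_lim:
  fixes C :: "'a::metric_space set"
  assumes "\<mu> \<in> borel_probs" "closed C" "C \<noteq> {}"
  shows "(\<lambda>n. \<integral>x. max 0 (1 - real n * infdist x C) \<partial>\<mu>) \<longlonglongrightarrow> measure \<mu> C"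
proof -
  interpret prob_space \<mu> using assms by (simp add: borel_probs_def)
  have sets: "sets \<mu> = sets borel" using assms by (auto simp: borel_probs_def)
  have C: "C \<in> sets \<mu>" using assms by (simp add: sets)
  have "(\<lambda>n. \<integral>x. max 0 (1 - real n * infdist x C) \<partial>\<mu>) \<longlonglongrightarrow> (\<integral>x. indicator C x \<partial>\<mu>)"
  proof (rule integral_dominated_convergence[where w = "\<lambda>_. 1"])
    show "(\<lambda>x. max 0 (1 - real n * infdist x C)) \<in> borel_measurable \<mu>" for n
    proof -
      obtain f :: "'a lipb" where "apply_lipb f = (\<lambda>x. max 0 (1 - real n * infdist x C))"
        by (rule closed_distance_profile_lipb)
      thus ?thesis
        using borel_measurable_integrable[OF integrable_apply_lipb[OF assms(1), of f]] by simp
    qed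
    show "AE x in \<mu>. (\<lambda>n. max 0 (1 - real n * infdist x C)) \<longlonglongrightarrow> indicator C x"
    proof (intro AE_I2)
      fix x
      show "(\<lambda>n. max 0 (1 - real n * infdist x C)) \<longlonglongrightarrow> indicator C x"
      proof (cases "x \<in> C")
        case False
        hence pos: "0 < infdist x C"
          using assms by (simp add: infdist_pos_not_in_closed)
        obtain N :: nat where N: "1 / infdist x C < real N"
          using reals_Archimedean2 by blast
        have "max 0 (1 - real n * infdist x C) = 0" if "n \<ge> N" for n
        proof -
          have "1 / infdist x C < real n" using N that by linarith
          thus ?thesis using pos by (simp add: divide_less_eq)
        qed
        hence "\<forall>\<^sub>F n in sequentially. max 0 (1 - real n * infdist x C) = indicator C x"
          using False by (auto simp: eventually_sequentially)
        thus ?thesis by (rule tendsto_eventually)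
      qed simp
    qed
  qed (use C in \<open>auto simp: infdist_nonneg\<close>)
  moreover have "space \<mu> = UNIV" using sets_eq_imp_space_eq[OF sets] by simp
  ultimately show ?thesis by simp
qed

lemma lipb_separates_measures:
  fixes \<mu> \<nu> :: "'a::metric_space measure"
  assumes "\<mu> \<in> borel_probs" "\<nu> \<in> borel_probs" "\<mu> \<noteq> \<nu>"
  obtains f :: "'a lipb" where "\<And>x. \<bar>f x\<bar> \<le> 1" "(\<integral>x. f x \<partial>\<mu>) < (\<integral>x. f x \<partial>\<nu>)"
proof -
  have "\<exists>C. closed C \<and> measure \<mu> C \<noteq> measure \<nu> C"
  proof (rule ccontr)
    assume "\<not> ?thesis"
    hence "measure \<mu> C = measure \<nu> C" if "closed C" for C
      using that by simp
    hence "\<mu> = \<nu>" by (rule borel_probs_eqI_closed[OF assms(1,2)])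
    with assms(3) show False ..
  qed
  then obtain C where C: "closed C" "measure \<mu> C \<noteq> measure \<nu> C" by (elim exE conjE)
  have ne: "C \<noteq> {}"
  proof
    assume "C = {}"
    with C(2) show False by simp
  qed
  have "\<exists>n. (\<integral>x. max 0 (1 - real n * infdist x C) \<partial>\<mu>) \<noteq> (\<integral>x. max 0 (1 - real n * infdist x C) \<partial>\<nu>)"
  proof (rule ccontr)
    assume "\<not> ?thesis"
    hence "(\<lambda>n. \<integral>x. max 0 (1 - real n * infdist x C) \<partial>\<mu>) \<longlonglongrightarrow> measure \<nu> C"
      using measure_closed_eq_lim[OF assms(2) C(1) ne] by simp
    thus False
      using LIMSEQ_unique[OF measure_closed_eq_lim[OF assms(1) C(1) ne]] C(2) by blast
  qed
  then obtain n where n: "(\<integral>x. max 0 (1 - real n * infdist x C) \<partial>\<mu>) \<noteq> (\<integral>x. max 0 (1 - real n * infdist x C) \<partial>\<nu>)"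
    by blast
  obtain f :: "'a lipb" where f: "apply_lipb f = (\<lambda>x. max 0 (1 - real n * infdist x C))"
    by (rule closed_distance_profile_lipb)
  have bd: "\<bar>f x\<bar> \<le> 1" "\<bar>(- f) x\<bar> \<le> 1" for x
    by (auto simp: f infdist_nonneg)
  show thesis
  proof (cases "(\<integral>x. f x \<partial>\<mu>) < (\<integral>x. f x \<partial>\<nu>)")
    case True
    show thesis by (rule that[of f, OF bd(1) True])
  next
    case False
    hence less: "(\<integral>x. (- f) x \<partial>\<mu>) < (\<integral>x. (- f) x \<partial>\<nu>)"
      using n by (simp add: f)
    show thesis by (rule that[of "- f", OF bd(2) less])
  qed
qed

section \<open>The scalar problem\<close>

text \<open>
  The logarithm of the maximiser of \<open>u \<mapsto> u powr (1/p) - u\<close>, \<open>p = e\<^sup>b\<close>: it solves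
  \<open>c = c e\<^sup>-\<^sup>b - b\<close>, the vanishing of the derivative.
\<close>

definition crit_log :: "real \<Rightarrow> real" where
  "crit_log b = - b / (1 - exp (- b))"

definition background :: "real \<Rightarrow> real \<Rightarrow> real" where
  "background b s = exp (crit_log b * exp (- b * s))"

lemma background_pos: "0 < background b s"
  by (simp add: background_def)

text \<open>
  This is the critical point equation for the initial value. Since \<open>background b s * exp (- b * s)\<close>
  is the derivative of \<open>exp (c * exp (- b * s))\<close> in \<open>c\<close>, it also says that a linearised
  perturbation enters the two end values with the same weight.
\<close>

lemma background_balance:
  assumes "0 < b"
  shows "background b 1 * exp (- b) = background b 0"
proof -
  have "crit_log b * (1 - exp (- b)) = - b"
    using assms by (simp add: crit_log_def)
  hence "crit_log b * exp (- b) + - b = crit_log b"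
    by (simp add: algebra_simps)
  thus ?thesis by (simp add: background_def flip: exp_add)
qed

lemma C_const_background:
  assumes "0 < b"
  shows "C_const b = background b 1 - background b 0"
proof -
  define p where "p = exp b"
  have p: "1 < p" "ln p = b" using assms by (auto simp: p_def)
  have ep: "exp (- b) = 1 / p" by (simp add: p_def exp_minus inverse_eq_divide)
  have "- (p / (p - 1)) / p * b = crit_log b * exp (- b)"
    using p by (simp add: crit_log_def ep field_simps)
  hence "p powr (- (p / (p - 1)) / p) = background b 1"
    using p by (simp add: powr_def background_def)
  moreover have "1 / (p / (p - 1)) = 1 - exp (- b)"
    using p by (simp add: ep field_simps)
  ultimately have "C_const b = (1 - exp (- b)) * background b 1"
    unfolding C_const_def Let_def p_def[symmetric] by simp
  thus ?thesis using background_balance[OF assms] by (simp add: algebra_simps)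
qed

lemma C_const_pos:
  assumes "0 < b"
  shows "0 < C_const b"
proof -
  have "background b 1 * exp (- b) < background b 1 * 1"
    using assms background_pos by (intro mult_strict_left_mono) auto
  thus ?thesis using C_const_background[OF assms] background_balance[OF assms] by simp
qed

text \<open>
  As a function of \<open>u = exp t\<close> the left-hand side is concave and has its maximum at
  \<open>u = background b 0\<close>. The tangent line inequality at that point is the convexity of \<open>exp\<close>
  between \<open>0\<close> and \<open>t - crit_log b\<close>.
\<close>

lemma exp_gap_le_C_const:
  assumes "0 < b"
  shows "exp (exp (- b) * t) - exp t \<le> C_const b"
proof -
  define k where "k = exp (- b)"
  have k: "0 \<le> k" "k \<le> 1" using assms by (auto simp: k_def)
  define r where "r = t - crit_log b"
  have "convex_on UNIV (exp :: real \<Rightarrow> real)" by (rule exp_convex)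
  (* k r is the convex combination of 0 and r with weights 1 - k and k. *)
  from convex_onD[OF this, of k 0 r] k have "exp (k * r) \<le> (1 - k) + k * exp r"
    by simp
  hence "background b 1 * exp (k * r) \<le> background b 1 * ((1 - k) + k * exp r)"
    using background_pos by (intro mult_left_mono) (auto intro: less_imp_le)
  moreover have "background b 1 * exp (k * r) = exp (k * t)"
    by (simp add: background_def r_def k_def algebra_simps flip: exp_add)
  moreover have "background b 1 * ((1 - k) + k * exp r)
      = background b 1 - background b 1 * k + background b 1 * k * exp r"
    by (simp add: algebra_simps)
  moreover have "background b 1 * k = background b 0"
    using background_balance[OF assms] by (simp add: k_def)
  moreover have "background b 0 * exp r = exp t"
    by (simp add: background_def r_def flip: exp_add)
  ultimately show ?thesis using C_const_background[OF assms] by (simp add: k_def)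
qed

section \<open>The upper bound for equal measures\<close>

text \<open>
  A Gronwall estimate along \<open>s\<close> at a fixed point \<open>x\<close>. The slope term has a favourable sign, so
  \<open>u = ln \<phi>\<^sub>s(x)\<close> satisfies \<open>u' + b u \<le> 0\<close>.
\<close>

lemma E_class_ln_decay:
  fixes \<phi> :: "real \<Rightarrow> 'a::metric_space lipb"
  assumes "\<phi> \<in> E_class a b" "0 \<le> a"
  shows "ln (\<phi> 1 x) \<le> exp (- b) * ln (\<phi> 0 x)"
proof -
  obtain c M \<phi>' where c: "0 < c" "\<And>s x. s \<in> {0..1} \<Longrightarrow> c \<le> \<phi> s x"
    and D: "\<And>s. s \<in> {0..1} \<Longrightarrow> (\<phi> has_vector_derivative \<phi>' s) (at s within {0..1})"
    and ineq: "\<And>s x. s \<in> {0..1} \<Longrightarrow> apply_lipb (\<phi>' s) x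
                + a * \<phi> s x * (enn2real (local_slope (\<lambda>y. ln (apply_lipb (\<phi> s) y)) x))\<^sup>2
                + b * \<phi> s x * ln (\<phi> s x) \<le> 0"
    using assms(1) unfolding E_class_def by blast
  have pos: "0 < \<phi> s x" if "s \<in> {0..1}" for s
    using c(1) c(2)[OF that, of x] by linarith
  have D': "((\<lambda>s. \<phi> s x) has_real_derivative \<phi>' s x) (at s within {0..1})" if "s \<in> {0..1}" for s
    using bounded_linear.has_vector_derivative[OF bounded_linear_apply_lipb D[OF that], of x]
    by (simp add: has_real_derivative_iff_has_vector_derivative)
  (* The integrating factor turns the inequality into monotonicity. *)
  define g where "g s = exp (b * s) * ln (\<phi> s x)" for s
  define g' where "g' s = exp (b * s) * (b * ln (\<phi> s x) + \<phi>' s x / \<phi> s x)" for s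
  have Dg: "(g has_real_derivative g' s) (at s within {0..1})" if "s \<in> {0..1}" for s
    unfolding g_def g'_def
    by (rule derivative_eq_intros D'[OF that] refl pos[OF that] | simp add: algebra_simps)+
  have g'_le: "g' s \<le> 0" if "s \<in> {0..1}" for s
  proof -
    have "0 \<le> a * \<phi> s x * (enn2real (local_slope (\<lambda>y. ln (apply_lipb (\<phi> s) y)) x))\<^sup>2"
      using assms(2) pos[OF that] by simp
    hence "\<phi>' s x + b * \<phi> s x * ln (\<phi> s x) \<le> 0"
      using ineq[OF that, of x] by linarith
    hence "(\<phi>' s x + b * \<phi> s x * ln (\<phi> s x)) / \<phi> s x \<le> 0"
      using pos[OF that] by (simp add: divide_le_0_iff)
    moreover have "(\<phi>' s x + b * \<phi> s x * ln (\<phi> s x)) / \<phi> s x = b * ln (\<phi> s x) + \<phi>' s x / \<phi> s x"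
      using pos[OF that] by (simp add: field_simps)
    ultimately show ?thesis unfolding g'_def by (simp add: mult_le_0_iff)
  qed
  have "\<exists>z\<in>{0<..<1}. g 1 - g 0 = (\<lambda>h. g' z * h) (1 - 0)"
    by (rule mvt_simple)
       (use Dg in \<open>auto simp: has_field_derivative_def\<close>)
  then obtain z where "z \<in> {0<..<1}" "g 1 - g 0 = g' z" by auto
  hence "g 1 \<le> g 0" using g'_le[of z] by simp
  hence "exp (- b) * (exp b * ln (\<phi> 1 x)) \<le> exp (- b) * ln (\<phi> 0 x)"
    unfolding g_def by (intro mult_left_mono) auto
  thus ?thesis by (simp flip: exp_add mult.assoc)
qed

lemma E_class_gap_le:
  fixes \<phi> :: "real \<Rightarrow> 'a::metric_space lipb"
  assumes "\<phi> \<in> E_class a b" "0 \<le> a" "0 < b"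
  shows "\<phi> 1 x - \<phi> 0 x \<le> C_const b"
proof -
  obtain c where c: "0 < c" "\<And>s x. s \<in> {0..1} \<Longrightarrow> c \<le> \<phi> s x"
    using assms(1) unfolding E_class_def by blast
  have pos: "0 < \<phi> 1 x" "0 < \<phi> 0 x" using c(1) c(2)[of 0 x] c(2)[of 1 x] by auto
  have "\<phi> 1 x \<le> exp (exp (- b) * ln (\<phi> 0 x))"
    using E_class_ln_decay[OF assms(1,2), of x] pos by (metis exp_le_cancel_iff exp_ln)
  thus ?thesis using exp_gap_le_C_const[OF assms(3), of "ln (\<phi> 0 x)"] pos by simp
qed

lemma T_cost_self_le:
  fixes \<mu> :: "'a::metric_space measure"
  assumes "\<mu> \<in> borel_probs" "0 \<le> a" "0 < b"
  shows "T_cost a b \<mu> \<mu> \<le> ereal (C_const b)"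
  unfolding T_cost_def
proof (rule SUP_least)
  fix \<phi> :: "real \<Rightarrow> 'a lipb" assume \<phi>: "\<phi> \<in> E_class a b"
  interpret prob_space \<mu> using assms by (simp add: borel_probs_def)
  have "(\<integral>x. \<phi> 1 x \<partial>\<mu>) - (\<integral>x. \<phi> 0 x \<partial>\<mu>) = (\<integral>x. \<phi> 1 x - \<phi> 0 x \<partial>\<mu>)"
    using integrable_apply_lipb[OF assms(1)] by simp
  also have "\<dots> \<le> (\<integral>x. C_const b \<partial>\<mu>)"
    using integrable_apply_lipb[OF assms(1)] E_class_gap_le[OF \<phi> assms(2,3)]
    by (intro integral_mono) auto
  also have "\<dots> = C_const b" by (simp add: prob_space)
  finally show "ereal ((\<integral>x. \<phi> 1 x \<partial>\<mu>) - (\<integral>x. \<phi> 0 x \<partial>\<mu>)) \<le> ereal (C_const b)"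
    by simp
qed

section \<open>Perturbing the optimal constant curve\<close>

text \<open>
  To first order in \<open>\<epsilon>\<close> this is \<open>exp (e\<^sup>-\<^sup>b\<^sup>s (c + \<epsilon> f))\<close>, the constant solution with its initial
  logarithm shifted by \<open>\<epsilon> f\<close>. Keeping it affine in \<open>f\<close> makes it a combination of two fixed vectors
  with smooth scalar coefficients, so differentiability in the Lipschitz norm is immediate.
\<close>

definition perturbed_curve :: "real \<Rightarrow> real \<Rightarrow> real \<Rightarrow> 'a::metric_space lipb \<Rightarrow> real \<Rightarrow> 'a lipb" where
  "perturbed_curve b \<epsilon> K f s =
     (background b s * (1 - exp (- b * s) * (\<epsilon>\<^sup>2 * K * s))) *\<^sub>R unit_lipb
       + (background b s * exp (- b * s) * \<epsilon>) *\<^sub>R f"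

lemma perturbed_curve_apply:
  "perturbed_curve b \<epsilon> K f s x
     = background b s * (1 + exp (- b * s) * (\<epsilon> * f x - \<epsilon>\<^sup>2 * K * s))"
  by (simp add: perturbed_curve_def unit_lipb.rep_eq algebra_simps)

lemma ln_lipschitz_above_half:
  fixes u v :: real
  assumes "1/2 \<le> u" "1/2 \<le> v"
  shows "\<bar>ln u - ln v\<bar> \<le> 2 * \<bar>u - v\<bar>"
proof -
  have *: "ln u - ln v \<le> 2 * \<bar>u - v\<bar>" if "1/2 \<le> u" "1/2 \<le> v" for u v :: real
  proof -
    have "ln u - ln v = ln (u / v)" using that by (simp add: ln_div)
    also have "\<dots> \<le> u / v - 1" using that by (intro ln_le_minus_one) auto
    also have "\<dots> = (u - v) / v" using that by (simp add: field_simps)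
    also have "\<dots> \<le> \<bar>u - v\<bar> / v" using that by (intro divide_right_mono) auto
    also have "\<dots> \<le> \<bar>u - v\<bar> / (1/2)" using that by (intro divide_left_mono) auto
    finally show ?thesis by simp
  qed
  show ?thesis using *[OF assms] *[OF assms(2,1)] by (simp add: abs_le_iff abs_minus_commute)
qed

text \<open>
  Write \<open>e = exp (- b s)\<close>, \<open>\<eta> = \<epsilon> f - \<epsilon>\<^sup>2 K s\<close> and \<open>\<phi> = y (1 + e \<eta>)\<close>. The terms of order zero and
  one cancel, and after estimating the logarithm by \<open>ln (1 + e \<eta>) \<le> e \<eta>\<close> what is left of
  \<open>\<phi>' + b \<phi> ln \<phi>\<close> is \<open>y e (b e \<eta>\<^sup>2 - \<epsilon>\<^sup>2 K)\<close>. The conditions on \<open>\<epsilon>\<close> give \<open>\<bar>\<eta>\<bar> \<le> 2 \<epsilon> \<le> 1/2\<close>. So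
  \<open>b e \<eta>\<^sup>2\<close> is at most \<open>4 b \<epsilon>\<^sup>2\<close>; moreover \<open>ln \<phi>\<close> has Lipschitz constant at most \<open>2 e \<epsilon> L\<close> and
  \<open>\<phi> \<le> 3 y / 2\<close>, so the slope term is at most \<open>y e (6 a L\<^sup>2 \<epsilon>\<^sup>2)\<close>. These two constants make up the
  lower bound for \<open>K\<close>.
\<close>

lemma perturbed_curve_in_E_class:
  fixes f :: "'a::metric_space lipb"
  assumes "0 \<le> a" "0 < b"
    and f: "\<And>x. \<bar>f x\<bar> \<le> 1" and L: "L-lipschitz_on UNIV (apply_lipb f)"
    and K: "4 * b + 6 * a * L\<^sup>2 \<le> K" and \<epsilon>: "0 \<le> \<epsilon>" "\<epsilon> \<le> 1/4" "\<epsilon> * K \<le> 1"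
  shows "perturbed_curve b \<epsilon> K f \<in> E_class a b"
proof -
  define c where "c = crit_log b"
  define e where "e s = exp (- b * s)" for s :: real
  define y where "y = background b"
  define \<eta> where "\<eta> s x = \<epsilon> * f x - \<epsilon>\<^sup>2 * K * s" for s x
  define \<phi> where "\<phi> = perturbed_curve b \<epsilon> K f"
  have K0: "0 \<le> K" using K assms(1,2) by (smt (verit) mult_nonneg_nonneg zero_le_power2)
  have L0: "0 \<le> L" using L by (rule lipschitz_on_nonneg)
  have y_pos: "0 < y s" for s by (simp add: y_def background_pos)
  have y_alt: "y s = exp (c * e s)" for s by (simp add: y_def background_def c_def e_def)
  have app: "\<phi> s x = y s * (1 + e s * \<eta> s x)" for s x
    by (simp add: \<phi>_def perturbed_curve_apply y_def e_def \<eta>_def)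
  have e: "0 < e s" "e s \<le> 1" if "s \<in> {0..1}" for s
    using that assms(2) by (auto simp: e_def)
  have \<eta>: "\<bar>\<eta> s x\<bar> \<le> 2 * \<epsilon>" if s: "s \<in> {0..1}" for s x
  proof -
    have "\<bar>\<epsilon> * f x\<bar> \<le> \<epsilon>" using f[of x] \<epsilon>(1) by (simp add: abs_mult mult_left_le)
    moreover have "\<epsilon>\<^sup>2 * K * s = \<epsilon> * ((\<epsilon> * K) * s)" by (simp add: power2_eq_square)
    moreover have "(\<epsilon> * K) * s \<le> 1 * 1" using \<epsilon> K0 s by (intro mult_mono) auto
    hence "\<epsilon> * ((\<epsilon> * K) * s) \<le> \<epsilon> * 1" using \<epsilon>(1) by (intro mult_left_mono) auto
    moreover have "0 \<le> \<epsilon> * ((\<epsilon> * K) * s)" using \<epsilon>(1) K0 s by simp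
    ultimately show ?thesis unfolding \<eta>_def by linarith
  qed
  have e\<eta>: "\<bar>e s * \<eta> s x\<bar> \<le> 1/2" if s: "s \<in> {0..1}" for s x
  proof -
    have "\<bar>e s\<bar> * \<bar>\<eta> s x\<bar> \<le> 1 * (1/2)"
      using e[OF s] \<eta>[OF s, of x] \<epsilon> by (intro mult_mono) auto
    thus ?thesis by (simp add: abs_mult)
  qed
  have half: "1/2 \<le> 1 + e s * \<eta> s x" "1 + e s * \<eta> s x \<le> 3/2" if "s \<in> {0..1}" for s x
    using e\<eta>[OF that, of x] by linarith+
  have bounds: "y s / 2 \<le> \<phi> s x" "\<phi> s x \<le> 3/2 * y s" if "s \<in> {0..1}" for s x
    using mult_left_mono[OF half(1)[OF that, of x], of "y s"]
      mult_left_mono[OF half(2)[OF that, of x], of "y s"] y_pos[of s]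
    by (auto simp: app)
  have y_bounds: "exp (- \<bar>c\<bar>) \<le> y s" "y s \<le> exp \<bar>c\<bar>" if "s \<in> {0..1}" for s
  proof -
    have "\<bar>c * e s\<bar> \<le> \<bar>c\<bar>" using e[OF that] by (simp add: abs_mult mult_left_le)
    thus "exp (- \<bar>c\<bar>) \<le> y s" "y s \<le> exp \<bar>c\<bar>" unfolding y_alt by auto
  qed

  define \<alpha>' where "\<alpha>' s = - b * c * e s * y s * (1 - e s * (\<epsilon>\<^sup>2 * K * s))
      + y s * (b * e s * (\<epsilon>\<^sup>2 * K * s) - e s * (\<epsilon>\<^sup>2 * K))" for s
  define \<beta>' where "\<beta>' s = - b * y s * e s * (c * e s + 1) * \<epsilon>" for s
  define \<phi>' where "\<phi>' s = \<alpha>' s *\<^sub>R unit_lipb + \<beta>' s *\<^sub>R f" for s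
  have De: "(e has_real_derivative - b * e s) (at s within {0..1})" for s
    unfolding e_def by (auto intro!: derivative_eq_intros)
  have Dy: "(y has_real_derivative - b * c * e s * y s) (at s within {0..1})" for s
    unfolding y_alt[abs_def] by (auto intro!: derivative_eq_intros De)
  have D\<alpha>: "((\<lambda>s. y s * (1 - e s * (\<epsilon>\<^sup>2 * K * s))) has_real_derivative \<alpha>' s) (at s within {0..1})" for s
    unfolding \<alpha>'_def by (auto intro!: derivative_eq_intros De Dy simp: algebra_simps)
  have D\<beta>: "((\<lambda>s. y s * e s * \<epsilon>) has_real_derivative \<beta>' s) (at s within {0..1})" for s
    unfolding \<beta>'_def by (auto intro!: derivative_eq_intros De Dy simp: algebra_simps)
  have "\<phi> = (\<lambda>s. (y s * (1 - e s * (\<epsilon>\<^sup>2 * K * s))) *\<^sub>R unit_lipb + (y s * e s * \<epsilon>) *\<^sub>R f)"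
    by (auto simp: \<phi>_def perturbed_curve_def y_def e_def)
  moreover have scaleR_const: "((\<lambda>s. h s *\<^sub>R g) has_vector_derivative h' *\<^sub>R g) (at s within {0..1})"
    if "(h has_real_derivative h') (at s within {0..1})" for h h' s and g :: "'a lipb"
    using has_vector_derivative_scaleR[OF that has_vector_derivative_const[of g]] by simp
  ultimately have D\<phi>: "(\<phi> has_vector_derivative \<phi>' s) (at s within {0..1})" for s
    unfolding \<phi>'_def by (simp only:) (intro has_vector_derivative_add scaleR_const D\<alpha> D\<beta>)
  have "continuous_on {0..1} e" "continuous_on {0..1} y"
    unfolding y_alt[abs_def] e_def by (intro continuous_intros)+
  hence cont: "continuous_on {0..1} \<phi>'"
    unfolding \<phi>'_def \<alpha>'_def \<beta>'_def by (intro continuous_intros)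
  have \<phi>'_app: "\<phi>' s x = - b * c * e s * \<phi> s x - b * y s * e s * \<eta> s x - y s * e s * (\<epsilon>\<^sup>2 * K)" for s x
    by (simp add: \<phi>'_def unit_lipb.rep_eq \<alpha>'_def \<beta>'_def app \<eta>_def algebra_simps)

  have slope: "enn2real (local_slope (\<lambda>x. ln (\<phi> s x)) x) \<le> 2 * e s * \<epsilon> * L" if s: "s \<in> {0..1}" for s x
  proof -
    have "(2 * e s * \<epsilon> * L)-lipschitz_on UNIV (\<lambda>x. ln (\<phi> s x))"
    proof (rule lipschitz_onI)
      fix u v
      have "ln (\<phi> s u) - ln (\<phi> s v) = ln (1 + e s * \<eta> s u) - ln (1 + e s * \<eta> s v)"
        using half(1)[OF s, of u] half(1)[OF s, of v] y_pos[of s] by (simp add: app ln_mult)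
      hence "\<bar>ln (\<phi> s u) - ln (\<phi> s v)\<bar> \<le> 2 * \<bar>(1 + e s * \<eta> s u) - (1 + e s * \<eta> s v)\<bar>"
        using ln_lipschitz_above_half[OF half(1)[OF s, of u] half(1)[OF s, of v]] by simp
      also have "(1 + e s * \<eta> s u) - (1 + e s * \<eta> s v) = e s * \<epsilon> * (f u - f v)"
        by (simp add: \<eta>_def algebra_simps)
      also have "2 * \<bar>e s * \<epsilon> * (f u - f v)\<bar> = 2 * e s * \<epsilon> * \<bar>f u - f v\<bar>"
        using e[OF s] \<epsilon>(1) by (simp add: abs_mult)
      also have "\<dots> \<le> 2 * e s * \<epsilon> * (L * dist u v)"
        using e[OF s] \<epsilon>(1) lipschitz_onD[OF L, of u v]
        by (intro mult_left_mono) (auto simp: dist_real_def)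
      finally show "dist (ln (\<phi> s u)) (ln (\<phi> s v)) \<le> 2 * e s * \<epsilon> * L * dist u v"
        by (simp add: dist_real_def mult.assoc)
    qed (use e[OF s] \<epsilon>(1) L0 in auto)
    from local_slope_le[OF this, of x] show ?thesis
      using e[OF s] \<epsilon>(1) L0 by (intro enn2real_leI) auto
  qed

  have ineq: "\<phi>' s x + a * \<phi> s x * (enn2real (local_slope (\<lambda>x. ln (\<phi> s x)) x))\<^sup>2
      + b * \<phi> s x * ln (\<phi> s x) \<le> 0" if s: "s \<in> {0..1}" for s x
  proof -
    have \<phi>_pos: "0 < \<phi> s x" using bounds(1)[OF s, of x] y_pos[of s] by linarith
    have "ln (1 + e s * \<eta> s x) \<le> e s * \<eta> s x"
      using half(1)[OF s, of x] ln_le_minus_one[of "1 + e s * \<eta> s x"] by simp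
    moreover have "ln (\<phi> s x) = c * e s + ln (1 + e s * \<eta> s x)"
      using half(1)[OF s, of x] by (simp add: app ln_mult y_alt)
    ultimately have "b * \<phi> s x * ln (\<phi> s x) \<le> b * \<phi> s x * (c * e s + e s * \<eta> s x)"
      using assms(2) \<phi>_pos by (intro mult_left_mono) auto
    moreover have "- b * c * e s * \<phi> s x - b * y s * e s * \<eta> s x + b * \<phi> s x * (c * e s + e s * \<eta> s x)
        = y s * e s * (e s * (b * (\<eta> s x)\<^sup>2))"
      by (simp add: app algebra_simps power2_eq_square)
    moreover have "e s * (b * (\<eta> s x)\<^sup>2) \<le> 1 * (b * (2 * \<epsilon>)\<^sup>2)"
      using e[OF s] assms(2) power_mono[OF \<eta>[OF s, of x], of 2]
      by (intro mult_mono mult_left_mono) auto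
    hence "y s * e s * (e s * (b * (\<eta> s x)\<^sup>2)) \<le> y s * e s * (4 * b * \<epsilon>\<^sup>2)"
      using y_pos[of s] e[OF s] by (intro mult_left_mono) auto
    ultimately have 1: "\<phi>' s x + b * \<phi> s x * ln (\<phi> s x)
        \<le> y s * e s * (4 * b * \<epsilon>\<^sup>2) - y s * e s * (\<epsilon>\<^sup>2 * K)"
      unfolding \<phi>'_app by linarith
    have "(enn2real (local_slope (\<lambda>x. ln (\<phi> s x)) x))\<^sup>2 \<le> (2 * e s * \<epsilon> * L)\<^sup>2"
      using slope[OF s, of x] by (intro power_mono) auto
    hence "a * \<phi> s x * (enn2real (local_slope (\<lambda>x. ln (\<phi> s x)) x))\<^sup>2
        \<le> a * (3/2 * y s) * (2 * e s * \<epsilon> * L)\<^sup>2"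
      using assms(1) bounds(2)[OF s, of x] \<phi>_pos y_pos[of s] by (intro mult_mono) auto
    also have "\<dots> = y s * e s * (6 * a * L\<^sup>2 * \<epsilon>\<^sup>2) * e s"
      by (simp add: power2_eq_square)
    also have "\<dots> \<le> y s * e s * (6 * a * L\<^sup>2 * \<epsilon>\<^sup>2) * 1"
      using y_pos[of s] e[OF s] assms(1) by (intro mult_left_mono) auto
    finally have 2: "a * \<phi> s x * (enn2real (local_slope (\<lambda>x. ln (\<phi> s x)) x))\<^sup>2
        \<le> y s * e s * (6 * a * L\<^sup>2 * \<epsilon>\<^sup>2)" by simp
    have "(4 * b + 6 * a * L\<^sup>2) * \<epsilon>\<^sup>2 \<le> K * \<epsilon>\<^sup>2"
      using K by (intro mult_right_mono) auto
    hence "y s * e s * ((4 * b + 6 * a * L\<^sup>2) * \<epsilon>\<^sup>2) \<le> y s * e s * (K * \<epsilon>\<^sup>2)"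
      using y_pos[of s] e[OF s] by (intro mult_left_mono) auto
    with 1 2 show ?thesis by (simp add: algebra_simps)
  qed

  have "exp (- \<bar>c\<bar>) / 2 \<le> \<phi> s x \<and> \<phi> s x \<le> 3/2 * exp \<bar>c\<bar>" if "s \<in> {0..1}" for s x
    using bounds[OF that, of x] y_bounds[OF that] by linarith
  moreover have "0 < exp (- \<bar>c\<bar>) / 2" by simp
  ultimately have "\<exists>c>0. \<exists>M. \<forall>s\<in>{0..1}. \<forall>x. c \<le> \<phi> s x \<and> \<phi> s x \<le> M" by blast
  moreover have "\<exists>\<phi>'. (\<forall>s\<in>{0..1}. (\<phi> has_vector_derivative \<phi>' s) (at s within {0..1})) \<and>
      continuous_on {0..1} \<phi>' \<and>
      (\<forall>s\<in>{0..1}. \<forall>x. apply_lipb (\<phi>' s) x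
        + a * \<phi> s x * (enn2real (local_slope (\<lambda>y. ln (\<phi> s y)) x))\<^sup>2
        + b * \<phi> s x * ln (\<phi> s x) \<le> 0)"
    using D\<phi> cont ineq by blast
  ultimately show ?thesis unfolding E_class_def \<phi>_def by blast
qed

lemma T_cost_ge_perturbed:
  fixes f :: "'a::metric_space lipb"
  assumes "0 \<le> a" "0 < b" and \<mu>: "\<mu>0 \<in> borel_probs" "\<mu>1 \<in> borel_probs"
    and "\<And>x. \<bar>f x\<bar> \<le> 1" "L-lipschitz_on UNIV (apply_lipb f)"
    and "4 * b + 6 * a * L\<^sup>2 \<le> K" "0 \<le> \<epsilon>" "\<epsilon> \<le> 1/4" "\<epsilon> * K \<le> 1"
  shows "ereal (C_const b + background b 0 * (\<epsilon> * ((\<integral>x. f x \<partial>\<mu>1) - (\<integral>x. f x \<partial>\<mu>0)) - \<epsilon>\<^sup>2 * K))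
           \<le> T_cost a b \<mu>0 \<mu>1"
proof -
  interpret M0: prob_space \<mu>0 using \<mu> by (simp add: borel_probs_def)
  interpret M1: prob_space \<mu>1 using \<mu> by (simp add: borel_probs_def)
  let ?\<phi> = "perturbed_curve b \<epsilon> K f"
  have int: "integrable \<mu>0 (apply_lipb f)" "integrable \<mu>1 (apply_lipb f)"
    by (intro integrable_apply_lipb \<mu>)+
  have "(\<integral>x. ?\<phi> 0 x \<partial>\<mu>0) = background b 0 * (1 + \<epsilon> * (\<integral>x. f x \<partial>\<mu>0))"
    using int by (simp add: perturbed_curve_apply M0.prob_space)
  moreover have "(\<integral>x. ?\<phi> 1 x \<partial>\<mu>1)
      = background b 1 * (1 + exp (- b) * (\<epsilon> * (\<integral>x. f x \<partial>\<mu>1) - \<epsilon>\<^sup>2 * K))"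
    using int by (simp add: perturbed_curve_apply M1.prob_space)
  moreover have "\<dots> = background b 1 + background b 0 * (\<epsilon> * (\<integral>x. f x \<partial>\<mu>1) - \<epsilon>\<^sup>2 * K)"
    by (simp add: background_balance[OF assms(2), symmetric] algebra_simps)
  ultimately have "(\<integral>x. ?\<phi> 1 x \<partial>\<mu>1) - (\<integral>x. ?\<phi> 0 x \<partial>\<mu>0)
      = C_const b + background b 0 * (\<epsilon> * ((\<integral>x. f x \<partial>\<mu>1) - (\<integral>x. f x \<partial>\<mu>0)) - \<epsilon>\<^sup>2 * K)"
    using C_const_background[OF assms(2)] by (simp add: algebra_simps)
  moreover have "?\<phi> \<in> E_class a b"
    by (rule perturbed_curve_in_E_class[where L = L]) (use assms in auto)
  hence "ereal ((\<integral>x. ?\<phi> 1 x \<partial>\<mu>1) - (\<integral>x. ?\<phi> 0 x \<partial>\<mu>0)) \<le> T_cost a b \<mu>0 \<mu>1"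
    unfolding T_cost_def by (rule SUP_upper)
  ultimately show ?thesis by simp
qed

lemma C_const_le_T_cost:
  fixes \<mu>0 \<mu>1 :: "'a::metric_space measure"
  assumes "0 \<le> a" "0 < b" "\<mu>0 \<in> borel_probs" "\<mu>1 \<in> borel_probs"
  shows "ereal (C_const b) \<le> T_cost a b \<mu>0 \<mu>1"
  (* f = 0 and eps = 0: the optimal constant curve itself. *)
  using T_cost_ge_perturbed[OF assms, of 0 0 "4 * b" 0] by (simp add: lipschitz_on_def)

text \<open>
  The first-order gain \<open>\<epsilon> D\<close>, with \<open>D\<close> the gap of the integrals of a separating function, dominates
  the second-order loss \<open>\<epsilon>\<^sup>2 K\<close> as soon as \<open>\<epsilon> \<le> D / (2 K)\<close>.
\<close>

lemma C_const_less_T_cost: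
  fixes \<mu>0 \<mu>1 :: "'a::metric_space measure"
  assumes "0 \<le> a" "0 < b" "\<mu>0 \<in> borel_probs" "\<mu>1 \<in> borel_probs" "\<mu>0 \<noteq> \<mu>1"
  shows "ereal (C_const b) < T_cost a b \<mu>0 \<mu>1"
proof -
  obtain f :: "'a lipb" where f: "\<And>x. \<bar>f x\<bar> \<le> 1" "(\<integral>x. f x \<partial>\<mu>0) < (\<integral>x. f x \<partial>\<mu>1)"
    using lipb_separates_measures[OF assms(3,4,5)] by blast
  define D where "D = (\<integral>x. f x \<partial>\<mu>1) - (\<integral>x. f x \<partial>\<mu>0)"
  have D: "0 < D" using f(2) by (simp add: D_def)
  define L where "L = lip_const (apply_lipb f)"
  define K where "K = 4 * b + 6 * a * L\<^sup>2"
  have K: "0 < K" using assms(1,2) by (auto simp: K_def intro!: add_pos_nonneg)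
  define \<epsilon> where "\<epsilon> = min (1/4) (min (1 / K) (D / (2 * K)))"
  have \<epsilon>: "0 < \<epsilon>" "\<epsilon> \<le> 1/4" "\<epsilon> \<le> 1 / K" "\<epsilon> \<le> D / (2 * K)"
    using K D by (auto simp: \<epsilon>_def)
  have "\<epsilon> * K \<le> 1" "\<epsilon> * K \<le> D / 2"
    using \<epsilon>(3,4) K by (auto simp: field_simps)
  hence "\<epsilon> * (\<epsilon> * K) < \<epsilon> * D" using \<epsilon>(1) D by (intro mult_strict_left_mono) auto
  hence "0 < background b 0 * (\<epsilon> * D - \<epsilon>\<^sup>2 * K)"
    by (simp add: background_pos power2_eq_square mult.assoc)
  hence "ereal (C_const b) < ereal (C_const b + background b 0 * (\<epsilon> * D - \<epsilon>\<^sup>2 * K))"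
    by simp
  also have "\<dots> \<le> T_cost a b \<mu>0 \<mu>1"
    unfolding D_def
    by (rule T_cost_ge_perturbed[OF assms(1-4) f(1), where L = L])
       (use \<epsilon> \<open>\<epsilon> * K \<le> 1\<close> lipb_lipschitz in \<open>auto simp: L_def K_def\<close>)
  finally show ?thesis .
qed

section \<open>The divergence\<close>

lemma ln_ereal_quotient:
  fixes T :: ereal
  assumes "0 < C" "ereal C \<le> T"
  shows "0 \<le> ln_ereal (ereal (1 / C) * T)"
    and "ln_ereal (ereal (1 / C) * T) = 0 \<longleftrightarrow> T = ereal C"
proof -
  have "0 \<le> ln_ereal (ereal (1 / C) * T) \<and> (ln_ereal (ereal (1 / C) * T) = 0 \<longleftrightarrow> T = ereal C)"
  proof (cases T)
    case (real r)
    hence r: "C \<le> r" using assms(2) by simp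
    hence 1: "1 \<le> r / C" using assms(1) by (simp add: le_divide_eq)
    have eq: "ereal (1 / C) * T = ereal (r / C)" by (simp add: real)
    have "ln_ereal (ereal (1 / C) * T) = ereal (ln (r / C))"
      using 1 unfolding eq ln_ereal_def by simp
    moreover have "0 \<le> ln (r / C)" using 1 by (rule ln_ge_zero)
    moreover have "ln (r / C) = 0 \<longleftrightarrow> r / C = 1" using 1 by (intro ln_eq_zero_iff) linarith
    moreover have "r / C = 1 \<longleftrightarrow> r = C" using assms(1) by (simp add: divide_eq_eq)
    ultimately show ?thesis by (simp add: real)
  next
    case PInf
    thus ?thesis using assms(1) by (simp add: ln_ereal_def)
  next
    case MInf
    thus ?thesis using assms(2) by simp
  qed
  thus "0 \<le> ln_ereal (ereal (1 / C) * T)" "ln_ereal (ereal (1 / C) * T) = 0 \<longleftrightarrow> T = ereal C"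
    by blast+
qed

theorem proposition5p8:
  fixes a b :: real and \<mu>0 \<mu>1 :: "'a::metric_space measure"
  assumes "complete (UNIV :: 'a set)"
    and "\<forall>(x :: 'a) r. compact (cball x r)"
    and "separable_space (euclidean :: 'a topology)"
    and "length_space TYPE('a)"
    and "0 \<le> a" and "0 < b"
    and "\<mu>0 \<in> borel_probs" and "\<mu>1 \<in> borel_probs"
  shows "ereal (C_const b) \<le> T_cost a b \<mu>0 \<mu>1 \<and>
         (T_cost a b \<mu>0 \<mu>1 = ereal (C_const b) \<longleftrightarrow> \<mu>0 = \<mu>1) \<and>
         0 \<le> T_tilde a b \<mu>0 \<mu>1 \<and>
         (T_tilde a b \<mu>0 \<mu>1 = 0 \<longleftrightarrow> \<mu>0 = \<mu>1)"
proof -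
  note hyps = assms(5-8)
  have lower: "ereal (C_const b) \<le> T_cost a b \<mu>0 \<mu>1"
    by (rule C_const_le_T_cost[OF hyps])
  moreover have eq: "T_cost a b \<mu>0 \<mu>1 = ereal (C_const b) \<longleftrightarrow> \<mu>0 = \<mu>1"
    using C_const_less_T_cost[OF hyps] T_cost_self_le[OF assms(7,5,6)] lower
    by (metis antisym less_irrefl)
  ultimately show ?thesis
    unfolding T_tilde_def using ln_ereal_quotient[OF C_const_pos[OF assms(6)] lower] by simp
qed

end
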